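(* If each bus in $\mathcal{O}$ can be matched to one unique bus in $\mathcal{M}$ on $\mathcal{G}$ (that is, there is an injective map $\mu:\mathcal{O}\to\mathcal{M}$ with $\mu(n)$ adjacent to $n$ in $\mathcal{G}$ for every $n\in\mathcal{O}$), then the Jacobian matrix $\mathbf{J}(\mathbf{v}_1)$ related to single-slot probing ($T=1$) with phasor data has full generic rank.
   Context: Grid. A feeder is a finite graph $\mathcal{G}=(\mathcal{N}^+,\mathcal{L})$ with bus set $\mathcal{N}^+=\{0,\dots,N\}$ and line set $\mathcal{L}$. Its bus admittance matrix is $\mathbf{Y}=\mathbf{G}+j\mathbf{B}$ with $\mathbf{G},\mathbf{B}$ real; for $n\ne m$ the entries $G_{nm},B_{nm}$ are non-zero only on lines, and the sparsity pattern of $\mathbf{G}$ is taken to be: $G_{nm}\neq 0$ iff $n=m$ or $(n,m)\in\mathcal{L}$. The buses are partitioned as $\mathcal{N}^+=\mathcal{M}\cup\mathcal{O}$ (disjoint), $\mathcal{M}$ being the metered (probed) and $\mathcal{O}$ the non-metered buses; $M=|\mathcal{M}|$, $O=|\mathcal{O}|$, $N+1=M+O$. State and power flow functions. With voltage phasors $v_n=v_{r,n}+jv_{i,n}=u_ne^{j\theta_n}$, the state is $\mathbf{v}=[v_{r,0},\dots,v_{r,N},v_{i,0},\dots,v_{i,N}]^\top\in\mathbb{R}^{2(N+1)}$. As functions of $\mathbf{v}$: the squared voltage magnitude $u_n(\mathbf{v})=v_{r,n}^2+v_{i,n}^2$; the voltage angle $\theta_n(\mathbf{v})$; and the power injections $p_n(\mathbf{v})=v_{r,n}\sum_m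 (v_{r,m}G_{nm}-v_{i,m}B_{nm})+v_{i,n}\sum_m (v_{r,m}B_{nm}+v_{i,m}G_{nm})$, $q_n(\mathbf{v})=v_{i,n}\sum_m (v_{r,m}G_{nm}-v_{i,m}B_{nm})-v_{r,n}\sum_m (v_{r,m}B_{nm}+v_{i,m}G_{nm})$. Single-slot probing with phasor data. The unknown is one state $\mathbf{v}_1$; the equations prescribe $u_n(\mathbf{v}_1),\theta_n(\mathbf{v}_1),p_n(\mathbf{v}_1),q_n(\mathbf{v}_1)$ for all $n\in\mathcal{M}$ (there are no coupling equations). $\mathbf{J}(\mathbf{v}_1)$ is the $4M\times 2(N+1)$ Jacobian of these equations. Its sparsity pattern: the gradient row of $u_n$ or of $\theta_n$ has the pattern of row $n$ of $[\mathbf{I}_{N+1}~\mathbf{I}_{N+1}]$, and the gradient row of $p_n$ or of $q_n$ has the pattern of row $n$ of $[\mathbf{G}~\mathbf{G}]$. Generic rank. The generic rank of a matrix is the maximum rank attained when its non-zero entries (the entries in its sparsity pattern) are allowed to take arbitrary real values, independently. A matrix with at least as many rows as columns has full generic rank if its generic rank equals its number of columns. *)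

theory Defs
  imports "HOL-Analysis.Complex_Transcendental" "Jordan_Normal_Form.DL_Rank"
begin

text \<open>Vectors and matrices are those of Jordan_Normal_Form.\<close>

unbundle no vec_syntax
hide_type (open) Finite_Cartesian_Product.vec
hide_const (open) Finite_Cartesian_Product.vec Finite_Cartesian_Product.row
  Finite_Cartesian_Product.mat

definition sparsity :: "real mat \<Rightarrow> (nat \<times> nat) set" where
  "sparsity A = {(i, j). i < dim_row A \<and> j < dim_col A \<and> A $$ (i, j) \<noteq> 0}"

definition sparsity_class :: "nat \<Rightarrow> nat \<Rightarrow> (nat \<times> nat) set \<Rightarrow> real mat set" where
  "sparsity_class nr nc S = {A \<in> carrier_mat nr nc. sparsity A \<subseteq> S}"

definition generic_rank :: "nat \<Rightarrow> nat \<Rightarrow> (nat \<times> nat) set \<Rightarrow> nat" where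
  "generic_rank nr nc S = Max (vec_space.rank nr ` sparsity_class nr nc S)"

lemma ranks_finite_nonempty:
  "finite (vec_space.rank nr ` sparsity_class nr nc S)" "sparsity_class nr nc S \<noteq> {}"
proof -
  have "vec_space.rank nr ` sparsity_class nr nc S \<subseteq> {0..nc}"
    by (auto simp: sparsity_class_def intro: vec_space.rank_le_nc)
  then show "finite (vec_space.rank nr ` sparsity_class nr nc S)"
    by (rule finite_subset) simp
  have "0\<^sub>m nr nc \<in> sparsity_class nr nc S"
    by (auto simp: sparsity_class_def sparsity_def)
  then show "sparsity_class nr nc S \<noteq> {}" by blast
qed

text \<open>The pattern \<open>S\<close> is a separate argument because it is structural: at a particular operating
  point the matrix \<open>A\<close> may have accidental zeros inside its pattern, but no non-zero outside.\<close>

definition full_generic_rank :: "real mat \<Rightarrow> (nat \<times> nat) set \<Rightarrow> bool" where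
  "full_generic_rank A S \<longleftrightarrow>
     A \<in> sparsity_class (dim_row A) (dim_col A) S \<and>
     dim_col A \<le> dim_row A \<and>
     generic_rank (dim_row A) (dim_col A) S = dim_col A"

text \<open>\<open>L\<close> is the adjacency relation of a simple undirected graph on \<open>{0..N}\<close>.\<close>

definition feeder :: "nat \<Rightarrow> nat rel \<Rightarrow> complex mat \<Rightarrow> bool" where
  "feeder N L Y \<longleftrightarrow>
     L \<subseteq> {0..N} \<times> {0..N} \<and> sym L \<and> irrefl L \<and>
     Y \<in> carrier_mat (N + 1) (N + 1) \<and>
     (\<forall>n\<le>N. \<forall>m\<le>N. Re (Y $$ (n, m)) \<noteq> 0 \<longleftrightarrow> n = m \<or> (n, m) \<in> L) \<and>
     (\<forall>n\<le>N. \<forall>m\<le>N. n \<noteq> m \<longrightarrow> Im (Y $$ (n, m)) \<noteq> 0 \<longrightarrow> (n, m) \<in> L)"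

text \<open>A state is a vector of dimension \<open>2 * (N + 1)\<close>: real parts first, then imaginary parts.\<close>

definition v_re :: "real vec \<Rightarrow> nat \<Rightarrow> real" where
  "v_re v n = v $ n"

definition v_im :: "nat \<Rightarrow> real vec \<Rightarrow> nat \<Rightarrow> real" where
  "v_im N v n = v $ (N + 1 + n)"

definition sq_mag :: "nat \<Rightarrow> nat \<Rightarrow> real vec \<Rightarrow> real" where
  "sq_mag N n v = (v_re v n)\<^sup>2 + (v_im N v n)\<^sup>2"

text \<open>Principal branch. Any other choice of branch changes the angle only by locally constant
  multiples of \<open>2 * pi\<close>, so the gradient agrees wherever the principal branch is differentiable. On the
  cut (and at 0) the partial derivatives in the two own coordinates may be unspecified reals; these
  positions belong to the pattern.\<close>

definition angle :: "nat \<Rightarrow> nat \<Rightarrow> real vec \<Rightarrow> real" where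
  "angle N n v = Arg (Complex (v_re v n) (v_im N v n))"

definition p_inj :: "nat \<Rightarrow> complex mat \<Rightarrow> nat \<Rightarrow> real vec \<Rightarrow> real" where
  "p_inj N Y n v =
     v_re v n * (\<Sum>m=0..N. v_re v m * Re (Y $$ (n, m)) - v_im N v m * Im (Y $$ (n, m))) +
     v_im N v n * (\<Sum>m=0..N. v_re v m * Im (Y $$ (n, m)) + v_im N v m * Re (Y $$ (n, m)))"

definition q_inj :: "nat \<Rightarrow> complex mat \<Rightarrow> nat \<Rightarrow> real vec \<Rightarrow> real" where
  "q_inj N Y n v =
     v_im N v n * (\<Sum>m=0..N. v_re v m * Re (Y $$ (n, m)) - v_im N v m * Im (Y $$ (n, m))) -
     v_re v n * (\<Sum>m=0..N. v_re v m * Im (Y $$ (n, m)) + v_im N v m * Re (Y $$ (n, m)))"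

definition set_coord :: "real vec \<Rightarrow> nat \<Rightarrow> real \<Rightarrow> real vec" where
  "set_coord v j t = vec (dim_vec v) (\<lambda>k. if k = j then t else v $ k)"

definition partial_deriv :: "(real vec \<Rightarrow> real) \<Rightarrow> nat \<Rightarrow> real vec \<Rightarrow> real" where
  "partial_deriv f j v = deriv (\<lambda>t. f (set_coord v j t)) (v $ j)"

definition jacobian :: "(real vec \<Rightarrow> real) list \<Rightarrow> real vec \<Rightarrow> real mat" where
  "jacobian fs v = mat (length fs) (dim_vec v) (\<lambda>(i, j). partial_deriv (fs ! i) j v)"

definition phasor_eqs :: "nat \<Rightarrow> complex mat \<Rightarrow> nat set \<Rightarrow> (real vec \<Rightarrow> real) list" where
  "phasor_eqs N Y M = (let ms = sorted_list_of_set M in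
     map (sq_mag N) ms @ map (angle N) ms @ map (p_inj N Y) ms @ map (q_inj N Y) ms)"

definition phasor_jacobian :: "nat \<Rightarrow> complex mat \<Rightarrow> nat set \<Rightarrow> real vec \<Rightarrow> real mat" where
  "phasor_jacobian N Y M v = jacobian (phasor_eqs N Y M) v"

text \<open>\<open>doubled_row A n\<close> is row \<open>n\<close> of the block matrix \<open>[A A]\<close>.\<close>

definition doubled_row :: "real mat \<Rightarrow> nat \<Rightarrow> real vec" where
  "doubled_row A n = row A n @\<^sub>v row A n"

text \<open>Rows in the same order as in \<open>phasor_eqs\<close>.\<close>

definition phasor_rows :: "nat \<Rightarrow> complex mat \<Rightarrow> nat set \<Rightarrow> real vec list" where
  "phasor_rows N Y M = (let ms = sorted_list_of_set M; I = 1\<^sub>m (N + 1); G = map_mat Re Y in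
     map (doubled_row I) ms @ map (doubled_row I) ms @
     map (doubled_row G) ms @ map (doubled_row G) ms)"

definition phasor_pattern :: "nat \<Rightarrow> complex mat \<Rightarrow> nat set \<Rightarrow> (nat \<times> nat) set" where
  "phasor_pattern N Y M = sparsity (mat_of_rows (2 * (N + 1)) (phasor_rows N Y M))"

text \<open>The Jacobian vanishes outside the pattern at every state.\<close>

lemma set_coord_index:
  assumes "v \<in> carrier_vec (2 * (N + 1))" "n \<le> N"
  shows "v_re (set_coord v j t) n = (if n = j then t else v_re v n)"
    and "v_im N (set_coord v j t) n = (if N + 1 + n = j then t else v_im N v n)"
  using assms by (auto simp: set_coord_def v_re_def v_im_def)

lemma doubled_row_one:
  assumes "n \<le> N" "j < 2 * (N + 1)"
  shows "doubled_row (1\<^sub>m (N + 1)) n $ j = (if j = n \<or> j = N + 1 + n then 1 else 0)"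
  using assms by (auto simp: doubled_row_def append_vec_def Let_def)

lemma doubled_row_Re:
  assumes "n \<le> N" "j < 2 * (N + 1)" "Y \<in> carrier_mat (N + 1) (N + 1)"
  shows "doubled_row (map_mat Re Y) n $ j =
    Re (Y $$ (n, if j < N + 1 then j else j - (N + 1)))"
  using assms by (auto simp: doubled_row_def append_vec_def Let_def)

lemma partial_deriv_const:
  assumes "\<And>t. f (set_coord v j t) = c"
  shows "partial_deriv f j v = 0"
  using assms by (simp add: partial_deriv_def)

lemma partial_sq_mag_angle_zero:
  assumes "n \<le> N" "j < 2 * (N + 1)" "v \<in> carrier_vec (2 * (N + 1))"
    and "doubled_row (1\<^sub>m (N + 1)) n $ j = 0"
  shows "partial_deriv (sq_mag N n) j v = 0" "partial_deriv (angle N n) j v = 0"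
proof -
  have "n \<noteq> j" "N + 1 + n \<noteq> j"
    using assms(4) unfolding doubled_row_one[OF assms(1,2)] by (auto split: if_splits)
  then show "partial_deriv (sq_mag N n) j v = 0" "partial_deriv (angle N n) j v = 0"
    by - (rule partial_deriv_const[where c = "sq_mag N n v"]
          partial_deriv_const[where c = "angle N n v"],
        simp add: sq_mag_def angle_def set_coord_index[OF assms(3,1)] del: One_nat_def)+
qed

lemma partial_inj_zero:
  assumes "feeder N L Y" "n \<le> N" "j < 2 * (N + 1)" "v \<in> carrier_vec (2 * (N + 1))"
    and "doubled_row (map_mat Re Y) n $ j = 0"
  shows "partial_deriv (p_inj N Y n) j v = 0" "partial_deriv (q_inj N Y n) j v = 0"
proof -
  define m where "m = (if j < N + 1 then j else j - (N + 1))"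
  have m: "m \<le> N" using assms(3) by (auto simp: m_def)
  have Y: "Y \<in> carrier_mat (N + 1) (N + 1)" using assms(1) by (simp add: feeder_def)
  have R: "Re (Y $$ (n, m)) = 0"
    using assms(5) doubled_row_Re[OF assms(2,3) Y] by (simp add: m_def)
  then have nm: "n \<noteq> m" "(n, m) \<notin> L" using assms(1,2) m by (auto simp: feeder_def)
  then have I: "Im (Y $$ (n, m)) = 0" using assms(1,2) m by (auto simp: feeder_def)
  have a: "k \<noteq> j" "N + 1 + k \<noteq> j" if "k \<noteq> m" "k \<le> N" for k
    using that by (auto simp: m_def split: if_splits)
  have c: "v_re (set_coord v j t) k = v_re v k" "v_im N (set_coord v j t) k = v_im N v k"
    if "k \<noteq> m" "k \<le> N" for k t
    using a[OF that] by (simp_all add: set_coord_index[OF assms(4) that(2)] del: One_nat_def)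
  have s1: "(\<Sum>k=0..N. v_re (set_coord v j t) k * Re (Y $$ (n, k)) - v_im N (set_coord v j t) k * Im (Y $$ (n, k)))
    = (\<Sum>k=0..N. v_re v k * Re (Y $$ (n, k)) - v_im N v k * Im (Y $$ (n, k)))" for t
  proof (rule sum.cong[OF refl])
    fix k assume "k \<in> {0..N}"
    then show "v_re (set_coord v j t) k * Re (Y $$ (n, k)) - v_im N (set_coord v j t) k * Im (Y $$ (n, k))
      = v_re v k * Re (Y $$ (n, k)) - v_im N v k * Im (Y $$ (n, k))"
      by (cases "k = m") (simp_all add: R I c)
  qed
  have s2: "(\<Sum>k=0..N. v_re (set_coord v j t) k * Im (Y $$ (n, k)) + v_im N (set_coord v j t) k * Re (Y $$ (n, k)))
    = (\<Sum>k=0..N. v_re v k * Im (Y $$ (n, k)) + v_im N v k * Re (Y $$ (n, k)))" for t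
  proof (rule sum.cong[OF refl])
    fix k assume "k \<in> {0..N}"
    then show "v_re (set_coord v j t) k * Im (Y $$ (n, k)) + v_im N (set_coord v j t) k * Re (Y $$ (n, k))
      = v_re v k * Im (Y $$ (n, k)) + v_im N v k * Re (Y $$ (n, k))"
      by (cases "k = m") (simp_all add: R I c)
  qed
  show "partial_deriv (p_inj N Y n) j v = 0" "partial_deriv (q_inj N Y n) j v = 0"
    by - (rule partial_deriv_const[where c = "p_inj N Y n v"]
          partial_deriv_const[where c = "q_inj N Y n v"],
        simp only: p_inj_def q_inj_def s1 s2 c[OF nm(1) assms(2)])+
qed

lemma list_all2_phasor:
  assumes "M \<subseteq> {0..N}"
    and "\<And>n. n \<in> M \<Longrightarrow> P (sq_mag N n) (doubled_row (1\<^sub>m (N + 1)) n)"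
    and "\<And>n. n \<in> M \<Longrightarrow> P (angle N n) (doubled_row (1\<^sub>m (N + 1)) n)"
    and "\<And>n. n \<in> M \<Longrightarrow> P (p_inj N Y n) (doubled_row (map_mat Re Y) n)"
    and "\<And>n. n \<in> M \<Longrightarrow> P (q_inj N Y n) (doubled_row (map_mat Re Y) n)"
  shows "list_all2 P (phasor_eqs N Y M) (phasor_rows N Y M)"
proof -
  have "set (sorted_list_of_set M) = M"
    using assms(1) by (meson finite_subset finite_atLeastAtMost set_sorted_list_of_set)
  then have *: "list_all2 P (map f (sorted_list_of_set M)) (map g (sorted_list_of_set M))"
    if "\<And>n. n \<in> M \<Longrightarrow> P (f n) (g n)" for f g
    using that by (simp add: list_all2_map1 list_all2_map2) (simp add: list_all2_same)
  show ?thesis unfolding phasor_eqs_def phasor_rows_def Let_def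
    by (intro list_all2_appendI * assms(2-5))
qed

lemma phasor_jacobian_in_class:
  assumes "feeder N L Y" "M \<subseteq> {0..N}" "v \<in> carrier_vec (2 * (N + 1))"
  shows "phasor_jacobian N Y M v \<in>
    sparsity_class (4 * card M) (2 * (N + 1)) (phasor_pattern N Y M)"
proof -
  have le: "n \<le> N" if "n \<in> M" for n using that assms(2) by auto
  have "list_all2 (\<lambda>f r. \<forall>j<2 * (N + 1). r $ j = 0 \<longrightarrow> partial_deriv f j v = 0)
    (phasor_eqs N Y M) (phasor_rows N Y M)"
    by (rule list_all2_phasor[OF assms(2)])
      (blast intro: partial_sq_mag_angle_zero[OF le _ assms(3)]
        partial_inj_zero[OF assms(1) le _ assms(3)])+
  moreover have "length (phasor_eqs N Y M) = 4 * card M"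
    by (simp add: phasor_eqs_def Let_def)
  ultimately show ?thesis
    using assms(3) unfolding sparsity_class_def phasor_pattern_def
    by (auto simp: phasor_jacobian_def jacobian_def sparsity_def list_all2_conv_all_nth
        mat_of_rows_def)
qed

text \<open>The pattern contains no position that is structurally zero. The incidence hypothesis is
  needed only for the diagonal entries of the reactive power rows: at an isolated bus with zero
  self-susceptance the reactive injection vanishes identically.\<close>

context
begin

private definition mk_state :: "nat \<Rightarrow> (nat \<Rightarrow> real) \<Rightarrow> (nat \<Rightarrow> real) \<Rightarrow> real vec" where
  "mk_state N a b = vec (2 * (N + 1)) (\<lambda>k. if k < N + 1 then a k else b (k - (N + 1)))"

private lemma mk_state:
  "mk_state N a b \<in> carrier_vec (2 * (N + 1))"
  "n \<le> N \<Longrightarrow> v_re (mk_state N a b) n = a n"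
  "n \<le> N \<Longrightarrow> v_im N (mk_state N a b) n = b n"
  by (auto simp: mk_state_def v_re_def v_im_def)

lemma set_coord_self: "j < dim_vec v \<Longrightarrow> set_coord v j (v $ j) = v"
  by (auto simp: set_coord_def)

lemma DERIV_coord:
  assumes "v \<in> carrier_vec (2 * (N + 1))" "n \<le> N"
  shows "((\<lambda>t. v_re (set_coord v j t) n) has_real_derivative (if n = j then 1 else 0)) (at x)"
    and "((\<lambda>t. v_im N (set_coord v j t) n) has_real_derivative (if N + 1 + n = j then 1 else 0)) (at x)"
  by (auto simp: set_coord_index[OF assms] simp del: One_nat_def)

lemma partial_sq_mag:
  assumes "v \<in> carrier_vec (2 * (N + 1))" "n \<le> N" "j < 2 * (N + 1)"
  shows "partial_deriv (sq_mag N n) j v =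
    2 * v_re v n * (if n = j then 1 else 0) + 2 * v_im N v n * (if N + 1 + n = j then 1 else 0)"
  unfolding partial_deriv_def sq_mag_def
  apply (rule DERIV_imp_deriv)
  apply (rule derivative_eq_intros DERIV_coord[OF assms(1,2)] refl)+
  using assms by (simp add: set_coord_self del: One_nat_def)

private lemma DERIV_fun_arctan_div:
  fixes f g :: "real \<Rightarrow> real"
  assumes "(f has_real_derivative f') (at x)" "(g has_real_derivative g') (at x)" "g x > 0"
  shows "((\<lambda>t. arctan (f t / g t)) has_real_derivative
    (g x * f' - f x * g') / ((g x)\<^sup>2 + (f x)\<^sup>2)) (at x)"
proof -
  have nz: "(g x)\<^sup>2 + (f x)\<^sup>2 \<noteq> 0" "g x \<noteq> 0"
    using assms(3) by (auto simp: sum_power2_eq_zero_iff)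
  have "1 + (f x / g x)\<^sup>2 = ((g x)\<^sup>2 + (f x)\<^sup>2) / (g x)\<^sup>2"
    using nz(2) by (simp add: field_simps)
  then have "inverse (1 + (f x / g x)\<^sup>2) * ((f' * g x - f x * g') / (g x * g x))
    = (g x * f' - f x * g') / ((g x)\<^sup>2 + (f x)\<^sup>2)"
    using nz by (simp add: power2_eq_square mult.commute)
  then show ?thesis
    using DERIV_chain2[OF DERIV_arctan DERIV_divide[OF assms(1,2) nz(2)]] by simp
qed

lemma partial_angle:
  assumes "v \<in> carrier_vec (2 * (N + 1))" "n \<le> N" "j < 2 * (N + 1)" "v_re v n > 0"
  shows "partial_deriv (angle N n) j v =
    (v_re v n * (if N + 1 + n = j then 1 else 0) - v_im N v n * (if n = j then 1 else 0)) / sq_mag N n v"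
proof -
  have s: "set_coord v j (v $ j) = v" using assms by (simp add: set_coord_self)
  have "((\<lambda>t. v_re (set_coord v j t) n) \<longlongrightarrow> v_re (set_coord v j (v $ j)) n) (nhds (v $ j))"
    using DERIV_isCont[OF DERIV_coord(1)[OF assms(1,2)]]
    by (metis (no_types) isCont_def tendsto_at_iff_tendsto_nhds)
  then have c: "((\<lambda>t. v_re (set_coord v j t) n) \<longlongrightarrow> v_re v n) (nhds (v $ j))"
    by (simp only: s)
  have "\<forall>\<^sub>F t in nhds (v $ j). v_re (set_coord v j t) n > 0"
    using order_tendstoD(1)[OF c assms(4)] .
  then have e: "\<forall>\<^sub>F t in nhds (v $ j). angle N n (set_coord v j t) =
     arctan (v_im N (set_coord v j t) n / v_re (set_coord v j t) n)"
    by eventually_elim (simp add: angle_def arg_conv_arctan)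
  have "((\<lambda>t. arctan (v_im N (set_coord v j t) n / v_re (set_coord v j t) n))
     has_real_derivative
     (v_re v n * (if N + 1 + n = j then 1 else 0) - v_im N v n * (if n = j then 1 else 0)) / sq_mag N n v) (at (v $ j))"
    using DERIV_fun_arctan_div[OF DERIV_coord(2,1)[OF assms(1,2)], of j "v $ j" j] assms(4) s
    by (simp only: s sq_mag_def)
  then show ?thesis
    unfolding partial_deriv_def using DERIV_cong_ev[OF refl e refl] DERIV_imp_deriv by blast
qed

private abbreviation (input) "dre m j \<equiv> (if m = j then 1 else 0 :: real)"
private abbreviation (input) "dimg N m j \<equiv> (if N + 1 + m = j then 1 else 0 :: real)"

private lemma DERIV_s:
  assumes "v \<in> carrier_vec (2 * (N + 1))"
  shows "((\<lambda>t. \<Sum>m=0..N. v_re (set_coord v j t) m * f m + v_im N (set_coord v j t) m * g m)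
    has_real_derivative (\<Sum>m=0..N. dre m j * f m + dimg N m j * g m)) (at x)"
  using assms by (intro DERIV_sum DERIV_add DERIV_cmult_right DERIV_coord) auto

private lemma s_eval:
  fixes j N :: nat
  assumes "j < 2 * (N + 1)"
  shows "(\<Sum>m=0..N. dre m j * f m + dimg N m j * g m) = (if j < N + 1 then f j else g (j - (N + 1)))"
proof (cases "j < N + 1")
  case True
  have "(\<Sum>m=0..N. dre m j * f m + dimg N m j * g m) = (\<Sum>m=0..N. if m = j then f m else 0)"
  proof (rule sum.cong[OF refl])
    fix m
    have "N + 1 + m \<noteq> j" using True by auto
    then show "dre m j * f m + dimg N m j * g m = (if m = j then f m else 0)" by simp
  qed
  then show ?thesis using True by simp
next
  case False
  have "(\<Sum>m=0..N. dre m j * f m + dimg N m j * g m) = (\<Sum>m=0..N. if m = j - (N + 1) then g m else 0)"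
  proof (rule sum.cong[OF refl])
    fix m assume "m \<in> {0..N}"
    then have "m \<noteq> j" "N + 1 + m = j \<longleftrightarrow> m = j - (N + 1)" using False by auto
    then show "dre m j * f m + dimg N m j * g m = (if m = j - (N + 1) then g m else 0)"
      by (simp only: if_False if_True mult_zero_left add_0_left) simp
  qed
  moreover have "j - (N + 1) \<le> N" using assms by auto
  ultimately show ?thesis using False by (simp del: One_nat_def)
qed

private abbreviation (input) "S1 N Y n v \<equiv> (\<Sum>m=0..N. v_re v m * Re (Y $$ (n, m)) + v_im N v m * - Im (Y $$ (n, m)))"
private abbreviation (input) "S2 N Y n v \<equiv> (\<Sum>m=0..N. v_re v m * Im (Y $$ (n, m)) + v_im N v m * Re (Y $$ (n, m)))"

private lemma partial_pq:
  fixes Y :: "complex mat"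
  assumes "v \<in> carrier_vec (2 * (N + 1))" "n \<le> N" "j < 2 * (N + 1)"
  defines "A \<equiv> (if j < N + 1 then Re (Y $$ (n, j)) else - Im (Y $$ (n, j - (N + 1))))"
    and "B \<equiv> (if j < N + 1 then Im (Y $$ (n, j)) else Re (Y $$ (n, j - (N + 1))))"
  shows "partial_deriv (p_inj N Y n) j v =
    dre n j * S1 N Y n v + v_re v n * A + dimg N n j * S2 N Y n v + v_im N v n * B"
   "partial_deriv (q_inj N Y n) j v =
    dimg N n j * S1 N Y n v + v_im N v n * A - dre n j * S2 N Y n v - v_re v n * B"
proof -
  have p: "p_inj N Y n = (\<lambda>v. v_re v n * S1 N Y n v + v_im N v n * S2 N Y n v)"
    by (auto simp: p_inj_def)
  have q: "q_inj N Y n = (\<lambda>v. v_im N v n * S1 N Y n v - v_re v n * S2 N Y n v)"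
    by (auto simp: q_inj_def)
  have s: "set_coord v j (v $ j) = v" using assms by (simp add: set_coord_self)
  note d = DERIV_coord[OF assms(1,2), of j "v $ j"]
    DERIV_s[OF assms(1), of j "\<lambda>m. Re (Y $$ (n, m))" "\<lambda>m. - Im (Y $$ (n, m))" "v $ j"]
    DERIV_s[OF assms(1), of j "\<lambda>m. Im (Y $$ (n, m))" "\<lambda>m. Re (Y $$ (n, m))" "v $ j"]
  note e = s_eval[OF assms(3), of "\<lambda>m. Re (Y $$ (n, m))" "\<lambda>m. - Im (Y $$ (n, m))"]
    s_eval[OF assms(3), of "\<lambda>m. Im (Y $$ (n, m))" "\<lambda>m. Re (Y $$ (n, m))"]
  note p1 = DERIV_add[OF DERIV_mult[OF d(1) d(3)] DERIV_mult[OF d(2) d(4)], unfolded s e]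
  note q1 = DERIV_diff[OF DERIV_mult[OF d(2) d(3)] DERIV_mult[OF d(1) d(4)], unfolded s e]
  show "partial_deriv (p_inj N Y n) j v =
    dre n j * S1 N Y n v + v_re v n * A + dimg N n j * S2 N Y n v + v_im N v n * B"
    unfolding partial_deriv_def p A_def B_def DERIV_imp_deriv[OF p1] by simp
  show "partial_deriv (q_inj N Y n) j v =
    dimg N n j * S1 N Y n v + v_im N v n * A - dre n j * S2 N Y n v - v_re v n * B"
    unfolding partial_deriv_def q A_def B_def DERIV_imp_deriv[OF q1] by simp
qed

lemma phasor_pattern_tight:
  assumes F: "feeder N L Y" and M: "M \<subseteq> {0..N}" and inc: "\<forall>n\<in>M. \<exists>m. (n, m) \<in> L"
    and ij: "(i, j) \<in> phasor_pattern N Y M"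
  shows "\<exists>v \<in> carrier_vec (2 * (N + 1)). phasor_jacobian N Y M v $$ (i, j) \<noteq> 0"
proof -
  define P where "P f r \<longleftrightarrow> (\<forall>j<2 * (N + 1). r $ j \<noteq> 0 \<longrightarrow>
    (\<exists>v \<in> carrier_vec (2 * (N + 1)). partial_deriv f j v \<noteq> 0))" for f and r :: "real vec"
  have Y: "Y \<in> carrier_mat (N + 1) (N + 1)" using F by (simp add: feeder_def)
  let ?one = "mk_state N (\<lambda>_. 1) (\<lambda>_. 1)"
  let ?e = "\<lambda>n. mk_state N (\<lambda>k. if k = n then 1 else 0) (\<lambda>_. 0)"
  let ?f = "\<lambda>n. mk_state N (\<lambda>_. 0) (\<lambda>k. if k = n then 1 else 0)"
  have S: "S1 N Y n (?e k) = Re (Y $$ (n, k))" "S2 N Y n (?f k) = Re (Y $$ (n, k))"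
    if "k \<le> N" for n k
  proof -
    have "S1 N Y n (?e k) = (\<Sum>m=0..N. if m = k then Re (Y $$ (n, m)) else 0)"
      by (intro sum.cong) (auto simp: mk_state)
    then show "S1 N Y n (?e k) = Re (Y $$ (n, k))" using that by simp
    have "S2 N Y n (?f k) = (\<Sum>m=0..N. if m = k then Re (Y $$ (n, m)) else 0)"
      by (intro sum.cong) (auto simp: mk_state)
    then show "S2 N Y n (?f k) = Re (Y $$ (n, k))" using that by simp
  qed
  have "list_all2 P (phasor_eqs N Y M) (phasor_rows N Y M)"
  proof (rule list_all2_phasor[OF M])
    fix n assume nM: "n \<in> M"
    then have n: "n \<le> N" using M by auto
    show "P (sq_mag N n) (doubled_row (1\<^sub>m (N + 1)) n)"
      unfolding P_def
    proof (intro allI impI bexI)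
      fix j assume j: "j < 2 * (N + 1)" "doubled_row (1\<^sub>m (N + 1)) n $ j \<noteq> 0"
      then show "partial_deriv (sq_mag N n) j ?one \<noteq> 0"
        unfolding partial_sq_mag[OF mk_state(1) n j(1)] using doubled_row_one[OF n j(1)]
        by (auto simp: mk_state n split: if_splits)
    qed (rule mk_state)
    show "P (angle N n) (doubled_row (1\<^sub>m (N + 1)) n)"
      unfolding P_def
    proof (intro allI impI bexI)
      fix j assume j: "j < 2 * (N + 1)" "doubled_row (1\<^sub>m (N + 1)) n $ j \<noteq> 0"
      have pos: "v_re ?one n > 0" by (simp add: mk_state n)
      show "partial_deriv (angle N n) j ?one \<noteq> 0"
        unfolding partial_angle[OF mk_state(1) n j(1) pos] using j doubled_row_one[OF n j(1)]
        by (auto simp: mk_state n sq_mag_def split: if_splits)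
    qed (rule mk_state)
    obtain m where nm: "(n, m) \<in> L" using inc nM by blast
    have m: "m \<le> N" "m \<noteq> n" using nm F by (auto simp: feeder_def irrefl_def)
    have mY: "Re (Y $$ (n, m)) \<noteq> 0" using nm F n m(1) unfolding feeder_def by blast
    have nn: "Re (Y $$ (n, n)) \<noteq> 0" using F n by (auto simp: feeder_def)
    show "P (p_inj N Y n) (doubled_row (map_mat Re Y) n)"
      unfolding P_def
    proof (intro allI impI)
      fix j assume j: "j < 2 * (N + 1)" "doubled_row (map_mat Re Y) n $ j \<noteq> 0"
      have r: "Re (Y $$ (n, if j < N + 1 then j else j - (N + 1))) \<noteq> 0"
        using j doubled_row_Re[OF n j(1) Y] by simp
      note p = partial_pq(1)[OF mk_state(1) n j(1), where Y = Y]
      have "partial_deriv (p_inj N Y n) j (?e n) \<noteq> 0" if "j < N + 1"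
        using that unfolding p S[OF n] using r nn n
        by (cases "j = n") (simp_all add: mk_state del: One_nat_def)
      moreover have "partial_deriv (p_inj N Y n) j (?f n) \<noteq> 0" if "\<not> j < N + 1"
        using that unfolding p S[OF n] using r nn n
        by (cases "j = N + 1 + n") (simp_all add: mk_state del: One_nat_def)
      ultimately show "\<exists>v \<in> carrier_vec (2 * (N + 1)). partial_deriv (p_inj N Y n) j v \<noteq> 0"
        by (meson mk_state(1))
    qed
    show "P (q_inj N Y n) (doubled_row (map_mat Re Y) n)"
      unfolding P_def
    proof (intro allI impI)
      fix j assume j: "j < 2 * (N + 1)" "doubled_row (map_mat Re Y) n $ j \<noteq> 0"
      have r: "Re (Y $$ (n, if j < N + 1 then j else j - (N + 1))) \<noteq> 0"
        using j doubled_row_Re[OF n j(1) Y] by simp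
      note q = partial_pq(2)[OF mk_state(1) n j(1), where Y = Y]
      consider "j = n" | "j = N + 1 + n" | "j \<noteq> n" "j < N + 1" | "j \<noteq> N + 1 + n" "\<not> j < N + 1"
        by linarith
      then have "partial_deriv (q_inj N Y n) j (?f m) \<noteq> 0 \<or> partial_deriv (q_inj N Y n) j (?e m) \<noteq> 0
        \<or> partial_deriv (q_inj N Y n) j (?f n) \<noteq> 0 \<or> partial_deriv (q_inj N Y n) j (?e n) \<noteq> 0"
      proof cases
        case 1
        then have "partial_deriv (q_inj N Y n) j (?f m) \<noteq> 0"
          unfolding q S[OF m(1)] using m mY n by (simp add: mk_state del: One_nat_def)
        then show ?thesis by blast
      next
        case 2
        then have "partial_deriv (q_inj N Y n) j (?e m) \<noteq> 0"
          unfolding q S[OF m(1)] using m mY n by (simp add: mk_state del: One_nat_def)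
        then show ?thesis by blast
      next
        case 3
        then have "partial_deriv (q_inj N Y n) j (?f n) \<noteq> 0"
          unfolding q S[OF n] using r n by (simp add: mk_state del: One_nat_def)
        then show ?thesis by blast
      next
        case 4
        then have "partial_deriv (q_inj N Y n) j (?e n) \<noteq> 0"
          unfolding q S[OF n] using r n by (simp add: mk_state del: One_nat_def)
        then show ?thesis by blast
      qed
      then show "\<exists>v \<in> carrier_vec (2 * (N + 1)). partial_deriv (q_inj N Y n) j v \<noteq> 0"
        by (meson mk_state(1))
    qed
  qed
  moreover have "i < length (phasor_rows N Y M)" "j < 2 * (N + 1)" "phasor_rows N Y M ! i $ j \<noteq> 0"
    using ij by (auto simp: phasor_pattern_def sparsity_def mat_of_rows_def)
  ultimately obtain v where v: "v \<in> carrier_vec (2 * (N + 1))" "i < length (phasor_eqs N Y M)"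
      "partial_deriv (phasor_eqs N Y M ! i) j v \<noteq> 0"
    unfolding list_all2_conv_all_nth P_def by metis
  then have "phasor_jacobian N Y M v $$ (i, j) \<noteq> 0"
    using \<open>j < 2 * (N + 1)\<close> by (auto simp: phasor_jacobian_def jacobian_def)
  then show ?thesis using v(1) by blast
qed

end

end

theory Submission
  imports Defs
begin

text \<open>A matching of the columns into the rows inside the pattern gives a 0-1 matrix whose columns
  are distinct unit vectors, so its rank is the number of columns. Such a matching is obtained by
  assigning the two columns of a metered bus to its own magnitude and angle rows, and the two
  columns of a non-metered bus \<open>n\<close> to the active and reactive power rows of \<open>\<mu> n\<close>.\<close>

lemma rank_partial_permutation:
  assumes inj: "inj_on \<rho> {0..<nc}" and less: "\<And>j. j < nc \<Longrightarrow> \<rho> j < nr"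
  shows "vec_space.rank nr (mat nr nc (\<lambda>(i, j). if i = \<rho> j then 1 else 0 :: real)) = nc"
proof -
  interpret vec_space "TYPE(real)" nr .
  let ?A = "mat nr nc (\<lambda>(i, j). if i = \<rho> j then 1 else 0 :: real)"
  have A: "?A \<in> carrier_mat nr nc" by simp
  have "distinct (cols ?A)"
    unfolding distinct_conv_nth
  proof (intro allI impI)
    fix i j assume "i < length (cols ?A)" "j < length (cols ?A)" "i \<noteq> j"
    then have ij: "i < nc" "j < nc" "\<rho> i \<noteq> \<rho> j" using inj by (auto simp: inj_on_def)
    have "col ?A i $ \<rho> i \<noteq> col ?A j $ \<rho> i" using ij less by simp
    then show "cols ?A ! i \<noteq> cols ?A ! j" using ij by auto
  qed
  moreover have "lin_indpt (set (cols ?A))"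
  proof
    assume "lin_dep (set (cols ?A))"
    then obtain v where v: "v \<in> carrier_vec nc" "v \<noteq> 0\<^sub>v nc" "?A *\<^sub>v v = 0\<^sub>v nr"
      using lin_depE[OF A _ \<open>distinct (cols ?A)\<close>] by blast
    have "v $ j = 0" if j: "j < nc" for j
    proof -
      \<comment> \<open>Injectivity leaves column \<open>j\<close> as the only one with a 1 in row
        \<open>\<rho> j\<close>, so that component of \<open>?A *\<^sub>v v = 0\<close> reads off
        \<open>v $ j\<close>.\<close>
      have "row ?A (\<rho> j) = unit_vec nc j"
        using j less[OF j] inj by (intro eq_vecI) (auto simp: inj_on_def)
      then have "(?A *\<^sub>v v) $ \<rho> j = v $ j"
        using j less[OF j] v(1) by simp
      then show ?thesis using v(3) less[OF j] by simp
    qed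
    then show False using v(1,2) by (metis carrier_vecD eq_vecI index_zero_vec)
  qed
  ultimately show ?thesis using lin_indpt_full_rank[OF A] by blast
qed

text \<open>No rank exceeds the number of columns, and the 0-1 matrix of the matching lies in the
  class and attains this bound.\<close>

lemma generic_rank_eq_dim_col:
  assumes "inj_on \<rho> {0..<nc}" and less: "\<And>j. j < nc \<Longrightarrow> \<rho> j < nr"
    and S: "\<And>j. j < nc \<Longrightarrow> (\<rho> j, j) \<in> S"
  shows "generic_rank nr nc S = nc"
  unfolding generic_rank_def
proof (rule Max_eqI)
  let ?A = "mat nr nc (\<lambda>(i, j). if i = \<rho> j then 1 else 0 :: real)"
  have "?A \<in> sparsity_class nr nc S"
    using S by (auto simp: sparsity_class_def sparsity_def split: if_splits)
  then show "nc \<in> vec_space.rank nr ` sparsity_class nr nc S"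
    using rank_partial_permutation[OF assms(1) less] by force
qed (use ranks_finite_nonempty in \<open>auto simp: sparsity_class_def intro: vec_space.rank_le_nc\<close>)

text \<open>The rows form four blocks of equal length: \<open>b\<close> = 0, 1, 2, 3 stands for
  magnitude, angle, active and reactive power, and \<open>i\<close> is the position of the bus
  within the block.\<close>

lemma phasor_rows_nth:
  assumes "b < 4" "i < card M"
  shows "phasor_rows N Y M ! (b * card M + i) =
    doubled_row (if b < 2 then 1\<^sub>m (N + 1) else map_mat Re Y) (sorted_list_of_set M ! i)"
proof -
  have "b = 0 \<or> b = 1 \<or> b = 2 \<or> b = 3" using assms(1) by auto
  then show ?thesis
    using assms(2) by (auto simp: phasor_rows_def Let_def nth_append)
qed

lemma block_index_less:
  assumes "b < d" "i < (k :: nat)"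
  shows "b * k + i < d * k"
proof -
  have "b * k + i < Suc b * k" using assms(2) by simp
  also have "\<dots> \<le> d * k" using assms(1) by (intro mult_le_mono1) simp
  finally show ?thesis .
qed

text \<open>Uniqueness of quotient and remainder modulo \<open>k\<close>: a row number determines
  its block and its position there.\<close>

lemma block_index_inject:
  assumes "i < k" "i' < k" "b * k + i = b' * k + (i' :: nat)"
  shows "b = b'" "i = i'"
proof -
  have "(b * k + i) div k = b" "(b' * k + i') div k = b'" using assms(1,2) by auto
  then show "b = b'" using assms(3) by simp
  then show "i = i'" using assms(3) by simp
qed

lemma phasor_pattern_iff:
  assumes "b < 4" "i < card M" "j < 2 * (N + 1)"
  shows "(b * card M + i, j) \<in> phasor_pattern N Y M \<longleftrightarrow>
    doubled_row (if b < 2 then 1\<^sub>m (N + 1) else map_mat Re Y) (sorted_list_of_set M ! i) $ j \<noteq> 0"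
proof -
  have "length (phasor_rows N Y M) = 4 * card M" by (simp add: phasor_rows_def Let_def)
  then show ?thesis
    using assms block_index_less[OF assms(1,2)]
    by (simp add: phasor_pattern_def sparsity_def mat_of_rows_def phasor_rows_nth)
qed

theorem theorem3:
  fixes N :: nat and L :: "nat rel" and Y :: "complex mat"
    and Met Non :: "nat set" and v1 :: "real vec"
  assumes "feeder N L Y"
    and "Met \<union> Non = {0..N}" and "Met \<inter> Non = {}"
    and "v1 \<in> carrier_vec (2 * (N + 1))"
    and "\<exists>\<mu>. inj_on \<mu> Non \<and> \<mu> ` Non \<subseteq> Met \<and> (\<forall>n\<in>Non. (n, \<mu> n) \<in> L)"
  shows "full_generic_rank (phasor_jacobian N Y Met v1) (phasor_pattern N Y Met)"
proof -
  obtain \<mu> where \<mu>: "inj_on \<mu> Non" "\<mu> ` Non \<subseteq> Met" "\<And>n. n \<in> Non \<Longrightarrow> (n, \<mu> n) \<in> L"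
    using assms(5) by blast
  have Met: "Met \<subseteq> {0..N}" using assms(2) by blast
  then have fin: "finite Met" by (rule finite_subset) simp
  have Y: "Y \<in> carrier_mat (N + 1) (N + 1)" using assms(1) by (simp add: feeder_def)
  let ?k = "card Met" and ?ms = "sorted_list_of_set Met" and ?nc = "2 * (N + 1)"
  have "\<forall>n\<in>Met. \<exists>i<?k. ?ms ! i = n"
    using fin by (metis in_set_conv_nth length_sorted_list_of_set set_sorted_list_of_set)
  \<comment> \<open>\<open>pos\<close> inverts the enumeration of the metered buses that orders each
    block.\<close>
  then obtain pos where pos: "\<And>n. n \<in> Met \<Longrightarrow> pos n < ?k \<and> ?ms ! pos n = n" by metis
  \<comment> \<open>\<open>bus\<close> names the metered bus whose rows serve a given bus. Column
    \<open>j\<close> belongs to bus \<open>j mod (N + 1)\<close>, and \<open>j div (N + 1)\<close>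
    is 0 for its real part, 1 for its imaginary part.\<close>
  define bus where "bus j = (if j \<in> Met then j else \<mu> j)" for j
  define blk where "blk j = (if j mod (N + 1) \<in> Met then j div (N + 1) else 2 + j div (N + 1))" for j
  define \<rho> where \<rho>: "\<rho> j = blk j * ?k + pos (bus (j mod (N + 1)))" for j
  have bus: "bus n \<in> Met" if "n \<le> N" for n
  proof -
    have "n \<in> Met \<union> Non" using that assms(2) by simp
    then show ?thesis using \<mu>(2) by (auto simp: bus_def)
  qed
  have modle: "j mod (N + 1) \<le> N" for j
    by (metis Suc_eq_plus1 less_Suc_eq_le mod_less_divisor zero_less_Suc)
  have div: "j div (N + 1) < 2" if "j < ?nc" for j
    using that by (simp add: less_mult_imp_div_less del: One_nat_def)
  have inB: "pos (bus (j mod (N + 1))) < ?k" for j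
    using pos bus modle by blast
  have blk: "blk j < 4" if "j < ?nc" for j
    using div[OF that] by (auto simp: blk_def)
  have inj: "inj_on \<rho> {0..<?nc}"
  proof (rule inj_onI)
    fix j j' assume "j \<in> {0..<?nc}" "j' \<in> {0..<?nc}" and eq: "\<rho> j = \<rho> j'"
    then have j: "j < ?nc" "j' < ?nc" by auto
    have b: "blk j = blk j'" and "pos (bus (j mod (N + 1))) = pos (bus (j' mod (N + 1)))"
      using block_index_inject[OF inB inB] eq unfolding \<rho> by blast+
    then have e: "bus (j mod (N + 1)) = bus (j' mod (N + 1))"
      using pos[OF bus[OF modle]] by metis
    \<comment> \<open>Metered buses use blocks 0 and 1, the others 2 and 3, so the block reveals
      both the kind of bus and the half of the state.\<close>
    have m: "j mod (N + 1) \<in> Met \<longleftrightarrow> j' mod (N + 1) \<in> Met"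
      and d: "j div (N + 1) = j' div (N + 1)"
      using b div[OF j(1)] div[OF j(2)] by (auto simp: blk_def split: if_splits)
    have Non: "j mod (N + 1) \<in> Met \<union> Non" "j' mod (N + 1) \<in> Met \<union> Non"
      unfolding assms(2) using modle by auto
    \<comment> \<open>\<open>bus\<close> is the identity on \<open>Met\<close> and the injective
      \<open>\<mu>\<close> on \<open>Non\<close>; the mixed case, where \<open>\<mu> n\<close> could
      collide with a metered bus, is excluded by \<open>m\<close>.\<close>
    have "j mod (N + 1) = j' mod (N + 1)"
      using e m Non \<mu>(1) unfolding bus_def by (auto split: if_splits dest: inj_onD)
    then show "j = j'" using d by (metis div_mod_decomp)
  qed
  have pat: "(\<rho> j, j) \<in> phasor_pattern N Y Met" if j: "j < ?nc" for j
  proof -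
    define n where "n = j mod (N + 1)"
    have n: "n \<le> N" using modle by (simp add: n_def)
    have n_if: "n = (if j < N + 1 then j else j - (N + 1))"
      unfolding n_def using j by (cases "j < N + 1") (auto simp: mod_if simp del: One_nat_def)
    then have j_cases: "j = n \<or> j = N + 1 + n" by (auto split: if_splits)
    have le: "bus n \<le> N" using bus[OF n] Met by auto
    note iff = phasor_pattern_iff[OF blk[OF j] inB j, of j Y, folded \<rho>]
    have ms: "?ms ! pos (bus (j mod (N + 1))) = bus n"
      using pos bus[OF n] by (simp add: n_def)
    show ?thesis
    proof (cases "n \<in> Met")
      case True
      then have "blk j < 2" "bus n = n" using div[OF j] by (auto simp: blk_def n_def bus_def)
      then show ?thesis
        unfolding iff ms using doubled_row_one[OF n j] j_cases by simp
    next
      case False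
      then have *: "\<not> blk j < 2" "bus n = \<mu> n" by (auto simp: blk_def n_def bus_def)
      have "n \<in> Non" using False n assms(2) by auto
      \<comment> \<open>The entry sits in row \<open>\<mu> n\<close> and column \<open>n\<close> of
        the conductance matrix, so the edge is reversed by symmetry of \<open>L\<close>.\<close>
      then have "(\<mu> n, n) \<in> L" using \<mu>(3) assms(1) by (auto simp: feeder_def dest: symD)
      then have "Re (Y $$ (\<mu> n, n)) \<noteq> 0"
        using assms(1) n le * unfolding feeder_def by metis
      then show ?thesis
        unfolding iff ms using * doubled_row_Re[OF le j Y] n_if by simp
    qed
  qed
  have less: "\<rho> j < 4 * ?k" if "j < ?nc" for j
    unfolding \<rho> using block_index_less[OF blk[OF that] inB] .
  \<comment> \<open>The matching itself shows that there are at least as many rows as columns, as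
    full generic rank demands.\<close>
  have "card {0..<?nc} \<le> card {0..<4 * ?k}"
    using less by (intro card_inj_on_le[OF inj]) auto
  moreover have "phasor_jacobian N Y Met v1 \<in> sparsity_class (4 * ?k) ?nc (phasor_pattern N Y Met)"
    using phasor_jacobian_in_class[OF assms(1) Met assms(4)] .
  moreover have "generic_rank (4 * ?k) ?nc (phasor_pattern N Y Met) = ?nc"
    using generic_rank_eq_dim_col[OF inj less pat] .
  ultimately show ?thesis
    unfolding full_generic_rank_def by (auto simp: sparsity_class_def)
qed

end
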